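(* For every integer $n \geq 6$ there are a positive integer $m$ and prime numbers $p_1 < \ldots < p_m$ such that $n = \sum_{j=1}^m (p_j+1)$. *)

theory Defs
  imports "HOL-Computational_Algebra.Primes"
begin

end

theory Submission imports Defs begin

text \<open>
  If every integer in \<open>[6, S - 6]\<close> is a sum of distinct \<open>p + 1\<close> with \<open>p \<le> x\<close>, where \<open>S\<close> is the
  sum of all these \<open>p + 1\<close>, then a prime \<open>x + 1\<close> extends the range to \<open>[6, S + x - 4]\<close> as soon as
  \<open>x + 13 \<le> S\<close>. This needs far less than Bertrand's postulate. As \<open>S\<close> is at least \<open>k (k + 5) / 2\<close>,
  where \<open>k\<close> is the number of primes up to \<open>x\<close>, a lower bound on \<open>k\<close> somewhat larger than
  \<open>sqrt (2 x)\<close> suffices. It comes from the fact that a common multiple of \<open>1, \<dots>, x\<close> is divisible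
  by \<open>x\<close> times each binomial coefficient of row \<open>x - 1\<close>, hence is at least \<open>2 ^ (x - 1)\<close>, while
  the least common multiple is at most \<open>x ^ k\<close>.
\<close>

section \<open>Common multiples and the number of primes\<close>

definition primes_upto :: "nat \<Rightarrow> nat set" where
  "primes_upto x = {p. prime p \<and> p \<le> x}"

lemma finite_primes_upto [simp]: "finite (primes_upto x)"
  unfolding primes_upto_def by (rule finite_subset[of _ "{..x}"]) auto

text \<open>For \<open>x > 0\<close> take \<open>D\<close> to be the least common multiple of
  \<open>1, ..., x\<close>. The power of \<open>p\<close> in it divides a single
  \<open>j \<le> x\<close>, so each prime contributes a factor of at most \<open>x\<close>.\<close>

lemma ex_common_multiple_le_power_card:
  obtains D :: nat where "D > 0" "\<forall>j\<in>{1..x}. j dvd D" "D \<le> x ^ card (primes_upto x)"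
proof (cases "x = 0")
  case True
  have "primes_upto x = {}" using True by (auto simp: primes_upto_def)
  then show ?thesis using that[of 1] True by simp
next
  case False
  define M where "M p = Max (multiplicity p ` {1..x})" for p :: nat
  define D where "D = (\<Prod>p\<in>primes_upto x. p ^ M p)"
  show ?thesis
  proof (rule that[of D])
    show "D > 0"
      unfolding D_def by (rule prod_pos) (auto simp: primes_upto_def prime_gt_0_nat)
  next
    show "\<forall>j\<in>{1..x}. j dvd D"
    proof
      fix j assume j: "j \<in> {1..x}"
      have sub: "prime_factors j \<subseteq> primes_upto x"
        using j by (auto simp: primes_upto_def prime_factors_dvd dest!: dvd_imp_le)
      have "j = (\<Prod>p\<in>prime_factors j. p ^ multiplicity p j)"
        using j by (subst prime_factorization_nat[symmetric]) auto
      also have "\<dots> dvd (\<Prod>p\<in>prime_factors j. p ^ M p)"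
        by (rule prod_dvd_prod, rule le_imp_power_dvd) (use j in \<open>auto simp: M_def intro!: Max_ge\<close>)
      also have "\<dots> dvd D"
        unfolding D_def by (rule prod_dvd_prod_subset) (use sub in auto)
      finally show "j dvd D" .
    qed
  next
    have "p ^ M p \<le> x" if "p \<in> primes_upto x" for p
    proof -
      have "M p \<in> multiplicity p ` {1..x}"
        unfolding M_def by (rule Max_in) (use False in auto)
      then obtain j where j: "j \<in> {1..x}" "M p = multiplicity p j" by auto
      have "p ^ M p dvd j" using j by (simp add: multiplicity_dvd)
      then show ?thesis using j by (auto dest!: dvd_imp_le)
    qed
    then have "D \<le> (\<Prod>p\<in>primes_upto x. x)"
      unfolding D_def by (intro prod_mono) auto
    then show "D \<le> x ^ card (primes_upto x)" by simp
  qed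
qed

text \<open>
  The reciprocals of the numbers \<open>(n + 1) * (n choose k)\<close> form Leibniz's harmonic triangle, in which
  each entry in column \<open>k + 1\<close> is a difference of two entries in column \<open>k\<close>.
\<close>

lemma Suc_times_binomial_dvd_common_multiple:
  assumes "\<forall>j\<in>{1..x}. j dvd D" "n < x" "k \<le> n"
  shows "Suc n * (n choose k) dvd (D :: nat)"
  using assms(2,3)
proof (induction k arbitrary: n)
  case 0
  then show ?case using assms(1) by simp
next
  case (Suc k)
  then obtain l where n: "n = Suc l" and kn: "k \<le> n" by (cases n) auto
  obtain a where a: "D = Suc l * (l choose k) * a"
    using Suc.IH[of l] Suc.prems n by (auto elim!: dvdE)
  obtain b where b: "D = Suc n * (n choose k) * b"
    using Suc.IH[of n] Suc.prems by (auto elim!: dvdE)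
  let ?A = "Suc l * (l choose k)" and ?C = "Suc n * (n choose Suc k)"
  have h1: "?A = Suc k * (n choose Suc k)" using Suc_times_binomial_eq[of l k] n by simp
  have h2: "Suc k * (n choose Suc k) = (n - k) * (n choose k)"
    using binomial_absorb_comp[of n k] binomial_absorption[of k n] n by simp
  have pos: "n choose k > 0" using kn by simp
  \<comment> \<open>This is \<open>D\<close> times the triangle identity 1/\<open>?C\<close> =
    1/\<open>?A\<close> - 1/(\<open>Suc n * (n choose k)\<close>), stated in \<open>int\<close> to
    avoid truncated subtraction.\<close>
  have "int D = int ?C * (int a - int b)"
  proof -
    define r s where "r = int (n choose k)" and "s = int (n choose Suc k)"
    have 1: "int D = (int k + 1) * s * int a"
      using a unfolding h1 s_def by (simp add: algebra_simps)
    have 2: "int D = (int n + 1) * r * int b"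
      using b unfolding r_def by (simp add: algebra_simps)
    have "int (Suc k) * s = int (n - k) * r"
      using h2 unfolding r_def s_def by (simp only: of_nat_mult[symmetric])
    then have 3: "(int k + 1) * s = (int n - int k) * r"
      using kn by (simp add: of_nat_diff algebra_simps)
    have "r * int D = r * ((int n + 1) * s * (int a - int b))" using 1 2 3 by algebra
    moreover have "r \<noteq> 0" using pos by (simp add: r_def)
    ultimately have "int D = (int n + 1) * s * (int a - int b)" by simp
    then show ?thesis by (simp add: s_def algebra_simps)
  qed
  then have "int ?C dvd int D" by (rule dvdI)
  then show ?case by (simp only: of_nat_dvd_iff)
qed

text \<open>Adding the bound \<open>x * ((x - 1) choose k) \<le> D\<close> over the \<open>x\<close>
  entries of row \<open>x - 1\<close> and cancelling \<open>x\<close> gives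
  \<open>2 ^ (x - 1) \<le> D\<close>.\<close>

lemma two_power_le_power_card_primes_upto:
  assumes "x > 0"
  shows "2 ^ (x - 1) \<le> x ^ card (primes_upto x)"
proof -
  obtain D :: nat where D: "D > 0" "\<forall>j\<in>{1..x}. j dvd D" "D \<le> x ^ card (primes_upto x)"
    using ex_common_multiple_le_power_card[of x] by blast
  have le: "x * ((x - 1) choose k) \<le> D" if "k \<le> x - 1" for k
    using Suc_times_binomial_dvd_common_multiple[OF D(2), of "x - 1" k] that assms D(1)
    by (auto dest: dvd_imp_le)
  have "x * 2 ^ (x - 1) = (\<Sum>k\<le>x - 1. x * ((x - 1) choose k))"
    using choose_row_sum[of "x - 1"] by (simp add: sum_distrib_left[symmetric])
  also have "\<dots> \<le> (\<Sum>k\<le>x - 1. D)" by (rule sum_mono) (use le in auto)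
  also have "\<dots> = x * D" using assms by simp
  finally have "2 ^ (x - 1) \<le> D" using assms by simp
  then show ?thesis using D(3) by simp
qed

section \<open>Growth of the sum of shifted primes\<close>

text \<open>Counting from 0, the i-th smallest element is at least c + i. The sum of these bounds is
  doubled and rearranged to avoid division and subtraction.\<close>

lemma sum_ge_card_triangular:
  fixes A :: "nat set"
  assumes "finite A" "\<And>a. a \<in> A \<Longrightarrow> a \<ge> c"
  shows "card A * (card A + 2 * c) \<le> 2 * sum id A + card A"
  using assms
proof (induction "card A" arbitrary: A)
  case 0
  then show ?case by simp
next
  case (Suc k)
  then have ne: "A \<noteq> {}" by auto
  let ?m = "Max A"
  have m: "?m \<in> A" using ne Suc by simp
  have card: "card (A - {?m}) = k" using Suc m by simp
  have IH: "k * (k + 2 * c) \<le> 2 * sum id (A - {?m}) + k"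
    using Suc.hyps(1)[of "A - {?m}"] Suc.prems card by auto
  have "A \<subseteq> {c..?m}" using Suc.prems by auto
  then have "Suc k \<le> card {c..?m}" unfolding Suc.hyps(2) by (intro card_mono) auto
  then have "k + c \<le> ?m" by simp
  moreover have "sum id A = ?m + sum id (A - {?m})"
    using sum.remove[of A ?m id] m Suc.prems by simp
  ultimately show ?case using IH unfolding Suc.hyps(2)[symmetric] by (simp add: algebra_simps)
qed

lemma three_square_plus_two_le_two_power: "9 \<le> t \<Longrightarrow> 3 * t ^ 2 + 2 \<le> (2 :: nat) ^ (t - 1)"
proof (induction t rule: dec_induct)
  case base
  then show ?case by simp
next
  case (step t)
  have "9 * t \<le> t ^ 2"
    unfolding power2_eq_square using step(1) by (intro mult_right_mono) simp_all
  then have "6 * t + 1 \<le> 3 * t ^ 2" using step(1) by linarith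
  then have "3 * Suc t ^ 2 + 2 \<le> 2 * (3 * t ^ 2 + 2)"
    by (simp add: power2_eq_square)
  also have "\<dots> \<le> 2 * 2 ^ (t - 1)" using step by simp
  also have "\<dots> = 2 ^ (Suc t - 1)" using step by (cases t) auto
  finally show ?case .
qed

definition shifted_prime_sum :: "nat \<Rightarrow> nat" where
  "shifted_prime_sum x = (\<Sum>p\<in>primes_upto x. p + 1)"

lemma shifted_prime_sum_ge_sum:
  assumes "A \<subseteq> primes_upto x"
  shows "(\<Sum>p\<in>A. p + 1) \<le> shifted_prime_sum x"
  unfolding shifted_prime_sum_def by (rule sum_mono2) (use assms in auto)

lemma shifted_prime_sum_ge_large:
  assumes "x \<ge> 500"
  shows "x + 13 \<le> shifted_prime_sum x"
proof (rule ccontr)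
  define k where "k = card (primes_upto x)"
  assume "\<not> ?thesis"
  moreover have "k * (k + 4) \<le> 2 * (\<Sum>p\<in>primes_upto x. p) + k"
    using sum_ge_card_triangular[of "primes_upto x" 2]
    by (auto simp: k_def id_def primes_upto_def[of x] prime_ge_2_nat)
  moreover have "shifted_prime_sum x = (\<Sum>p\<in>primes_upto x. p) + k"
    by (simp add: shifted_prime_sum_def sum.distrib k_def del: One_nat_def)
  ultimately have k: "k * k < 2 * x + 26" by (simp add: algebra_simps)
  \<comment> \<open>Replacing \<open>x\<close> by the power of two above it turns the bound on
    \<open>x ^ k\<close> into the linear \<open>x - 1 \<le> t * k\<close>. With \<open>k\<close> of
    order \<open>sqrt x\<close>, this bounds \<open>x\<close> by a multiple of \<open>t ^ 2\<close>,
    while \<open>x\<close> is at least \<open>2 ^ (t - 1)\<close>.\<close>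
  obtain s where s: "2 ^ s \<le> x" "x < 2 ^ Suc s"
    using ex_power_ivl1[of 2 x] assms by auto
  define t where "t = Suc s"
  have "2 ^ (x - 1) \<le> x ^ k"
    using two_power_le_power_card_primes_upto[of x] assms by (simp add: k_def)
  also have "\<dots> \<le> (2 ^ t) ^ k" by (rule power_mono) (use s in \<open>simp_all add: t_def\<close>)
  finally have "(2 :: nat) ^ (x - 1) \<le> 2 ^ (t * k)" by (simp only: power_mult)
  then have "x - 1 \<le> t * k" by (subst (asm) power_increasing_iff) auto
  then have "(x - 1) ^ 2 \<le> (t * k) ^ 2" by (rule power_mono) simp
  also have "\<dots> = t ^ 2 * (k * k)" by (simp only: power_mult_distrib power2_eq_square[of k])
  \<comment> \<open>Here \<open>2 * x + 26 \<le> 3 * (x - 1)\<close>, as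
    \<open>x \<ge> 29\<close>.\<close>
  also have "\<dots> \<le> t ^ 2 * (3 * (x - 1))" using k assms by (intro mult_left_mono) auto
  finally have "(x - 1) * (x - 1) \<le> 3 * t ^ 2 * (x - 1)"
    by (simp only: power2_eq_square[of "x - 1"] mult.commute mult.left_commute)
  then have le: "x - 1 \<le> 3 * t ^ 2" using assms by simp
  have "t \<ge> 9"
  proof (rule ccontr)
    assume "\<not> t \<ge> 9"
    then have "(2 :: nat) ^ t \<le> 2 ^ 8" by (intro power_increasing) auto
    then show False using s assms by (simp add: t_def)
  qed
  then have "3 * t ^ 2 + 2 \<le> 2 ^ s"
    using three_square_plus_two_le_two_power[of t] by (simp add: t_def)
  then show False using le s by linarith
qed

text \<open>Below 500, a few explicit primes suffice on each range; their shifted sums are 47 = 34 +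
  13, 158 and 600.\<close>

lemma shifted_prime_sum_ge:
  assumes "x \<ge> 13"
  shows "x + 13 \<le> shifted_prime_sum x"
proof -
  consider "x \<le> 34" | "34 < x" "x \<le> 121" | "121 < x" "x \<le> 500" | "500 \<le> x" by linarith
  then show ?thesis
  proof cases
    case 1
    have "{2, 3, 5, 7, 11, 13} \<subseteq> primes_upto x"
      using assms by (simp add: primes_upto_def)
    from shifted_prime_sum_ge_sum[OF this] 1 show ?thesis by simp
  next
    case 2
    have "{7, 11, 13, 17, 19, 23, 29, 31} \<subseteq> primes_upto x"
      using 2 by (simp add: primes_upto_def)
    from shifted_prime_sum_ge_sum[OF this] 2 show ?thesis by simp
  next
    case 3
    have "{71, 73, 79, 83, 89, 97, 101} \<subseteq> primes_upto x"
      using 3 by (simp add: primes_upto_def)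
    from shifted_prime_sum_ge_sum[OF this] 3 show ?thesis by simp
  next
    case 4
    then show ?thesis by (rule shifted_prime_sum_ge_large)
  qed
qed

section \<open>Representation by distinct shifted primes\<close>

lemma primes_upto_13: "primes_upto 13 = {2, 3, 5, 7, 11, 13}"
proof -
  have "primes_upto 13 = Set.filter prime {..13}" by (auto simp: primes_upto_def)
  also have "\<dots> = {2, 3, 5, 7, 11, 13}" by code_simp
  finally show ?thesis .
qed

text \<open>The base range, checked by evaluation: all six shifted primes add up to 47, and 41 = 47
  - 6.\<close>

lemma ex_subset_primes_upto_13:
  fixes n :: nat
  assumes "6 \<le> n" "n \<le> 41"
  shows "\<exists>A\<subseteq>{2, 3, 5, 7, 11, 13}. n = (\<Sum>p\<in>A. p + 1)"
proof -
  have "\<forall>n\<in>{6..41 :: nat}. \<exists>A\<in>Pow {2, 3, 5, 7, 11, 13}. n = (\<Sum>p\<in>A. p + 1)" by code_simp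
  then have "\<exists>A\<in>Pow {2, 3, 5, 7, 11, 13}. n = (\<Sum>p\<in>A. p + 1)"
    using assms by (simp only: atLeastAtMost_iff)
  then show ?thesis unfolding Pow_iff Bex_def .
qed

text \<open>The margin 6 at the top mirrors the one at the bottom: complementing \<open>A\<close>
  exchanges \<open>n\<close> with \<open>shifted_prime_sum x - n\<close>, and 5 is not a sum of
  distinct shifted primes.\<close>

lemma ex_subset_primes_upto:
  assumes "13 \<le> x" "6 \<le> n" "n + 6 \<le> shifted_prime_sum x"
  shows "\<exists>A\<subseteq>primes_upto x. n = (\<Sum>p\<in>A. p + 1)"
  using assms
proof (induction x arbitrary: n rule: dec_induct)
  case base
  then show ?case
    using ex_subset_primes_upto_13[of n] by (simp add: shifted_prime_sum_def primes_upto_13)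
next
  case (step x)
  show ?case
  proof (cases "prime (Suc x)")
    case False
    then have "primes_upto (Suc x) = primes_upto x" by (auto simp: primes_upto_def le_Suc_eq)
    then show ?thesis using step.IH[of n] step.prems by (simp only: shifted_prime_sum_def)
  next
    case True
    then have ins: "primes_upto (Suc x) = insert (Suc x) (primes_upto x)"
      by (auto simp: primes_upto_def le_Suc_eq)
    have notin: "Suc x \<notin> primes_upto x" by (simp add: primes_upto_def)
    have sum: "shifted_prime_sum (Suc x) = x + 2 + shifted_prime_sum x"
      using notin by (simp add: shifted_prime_sum_def ins)
    show ?thesis
    proof (cases "n + 6 \<le> shifted_prime_sum x")
      case True
      then obtain A where "A \<subseteq> primes_upto x" "n = (\<Sum>p\<in>A. p + 1)"
        using step.IH[of n] step.prems by blast
      then show ?thesis using ins by blast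
    next
      case False
      \<comment> \<open>With S = \<open>shifted_prime_sum x\<close>, the case gives n \<ge> S - 5,
        so S \<ge> x + 13 leaves at least 6 after removing x + 2.\<close>
      then have "6 \<le> n - (x + 2)" "n - (x + 2) + 6 \<le> shifted_prime_sum x" "x + 2 \<le> n"
        using shifted_prime_sum_ge[of x] step.hyps step.prems sum by linarith+
      then obtain A where A: "A \<subseteq> primes_upto x" "n - (x + 2) = (\<Sum>p\<in>A. p + 1)"
        using step.IH[of "n - (x + 2)"] by blast
      have "finite A" using A(1) finite_primes_upto by (rule finite_subset)
      moreover have "Suc x \<notin> A" using A(1) notin by blast
      ultimately have "n = (\<Sum>p\<in>insert (Suc x) A. p + 1)" using A(2) \<open>x + 2 \<le> n\<close> by simp
      moreover have "insert (Suc x) A \<subseteq> primes_upto (Suc x)" using A(1) ins by blast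
      ultimately show ?thesis by (intro exI conjI)
    qed
  qed
qed

theorem theorem1p4:
  fixes n :: nat
  assumes "n \<ge> 6"
  shows "\<exists>(m::nat) (p :: nat \<Rightarrow> nat).
           m > 0 \<and>
           (\<forall>j\<in>{1..m}. prime (p j)) \<and>
           strict_mono_on {1..m} p \<and>
           n = (\<Sum>j=1..m. (p j + 1))"
proof -
  \<comment> \<open>The cutoff \<open>n + 13\<close> is at least 13, and its shifted sum is at least
    \<open>n + 26\<close>.\<close>
  have "13 \<le> n + 13" "n + 6 \<le> shifted_prime_sum (n + 13)"
    using shifted_prime_sum_ge[of "n + 13"] by simp_all
  then obtain A where A: "A \<subseteq> primes_upto (n + 13)" "n = (\<Sum>p\<in>A. p + 1)"
    using ex_subset_primes_upto[of "n + 13" n] assms by blast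
  have fin: "finite A" using A(1) finite_primes_upto by (rule finite_subset)
  define xs where "xs = sorted_list_of_set A"
  \<comment> \<open>The shift passes from list positions, which start at 0, to indices from
    1.\<close>
  define p where "p j = xs ! (j - 1)" for j
  have len: "length xs = card A" and set: "set xs = A" and sd: "sorted_wrt (<) xs"
    using fin by (auto simp: xs_def)
  have "A \<noteq> {}" using A(2) assms by auto
  then have "card A > 0" using fin by (simp add: card_gt_0_iff)
  moreover have "\<forall>j\<in>{1..card A}. prime (p j)"
  proof
    fix j assume "j \<in> {1..card A}"
    then have "p j \<in> set xs" unfolding p_def by (intro nth_mem) (auto simp: len)
    then show "prime (p j)" using A(1) set by (auto simp: primes_upto_def)
  qed
  moreover have "strict_mono_on {1..card A} p"
    using sd by (force simp: strict_mono_on_def p_def len sorted_wrt_iff_nth_less)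
  moreover have "n = (\<Sum>j=1..card A. p j + 1)"
  proof -
    have "(\<Sum>a\<in>A. a + 1) = sum_list (map (\<lambda>a. a + 1) xs)"
      using fin set by (subst sum_list_distinct_conv_sum_set) (auto simp: xs_def)
    also have "\<dots> = (\<Sum>i<card A. xs ! i + 1)"
      by (simp add: sum_list_sum_nth len atLeast0LessThan)
    also have "\<dots> = (\<Sum>j=1..card A. p j + 1)"
      by (rule sum.reindex_bij_witness[of _ "\<lambda>j. j - 1" Suc]) (auto simp: p_def)
    finally show ?thesis using A(2) by simp
  qed
  ultimately show ?thesis by blast
qed

end
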